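(* Let $\lambda\in\{\lambda_2,\lambda_3,\lambda_4\}$ (the three specific positive constants defined in the context) and $\phi=\pi/4$. Let $\alpha,\beta,\gamma$ be real numbers with $\alpha\ne0$ and $\beta>\gamma>0$, and let $(V(n))_{n\ge0}$ be any sequence of integers satisfying, as $n\to\infty$, $$V(n)=(-1)^n\alpha\frac{e^{\beta\sqrt n}}{\sqrt n}\cos(\lambda\sqrt n+\phi)\bigl(1+O(n^{-1/2})\bigr)+O\!\left(\frac{e^{\gamma\sqrt n}}{\sqrt n}\right).$$ For $m\in\mathbb{Z}_{\ge0}$ put $t_m=\left(\frac{\pi-2\phi+2m\pi}{2\lambda}\right)^2$ and $N_m=\lfloor t_m\rfloor$. Let $\delta>0$ and let $\mathcal{M}\subset\mathbb{Z}_{\ge0}$ be an infinite set such that $\operatorname{dist}(t_m,\mathbb{Z})\ge\delta$ and $N_m>1$ for all $m\in\mathcal{M}$. Then for all sufficiently large $m\in\mathcal{M}$, $V(N_m)$ and $V(N_m+1)$ have the same sign, and at least one of $|V(N_m)|$ and $|V(N_m+1)|$ is a local minimum of the sequence $(|V(n)|)_{n\ge0}$.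
   Context: Constants: $D:=\operatorname{Im}\operatorname{Li}_2(e^{\pi i/3})=\sum_{n\ge1}\frac{\sin(n\pi/3)}{n^2}=1.014942\ldots$; $W_2=-\frac{\pi^2}{24}+\frac{i}{2}D$ and $W_3=W_4=\frac{i}{2}D$; $\lambda_j=2\operatorname{Im}(\sqrt{W_j})$ with the principal square root (so $\lambda_3=\lambda_4=\sqrt{D}$). The asymptotic hypothesis means: there are real sequences $\varepsilon_1(n),\varepsilon_2(n)$ and constants $C>0$, $n_0\ge1$ such that for all $n\ge n_0$, $V(n)=(-1)^n\alpha\frac{e^{\beta\sqrt n}}{\sqrt n}\cos(\lambda\sqrt n+\phi)(1+\varepsilon_1(n))+\varepsilon_2(n)$, with $|\varepsilon_1(n)|\le Cn^{-1/2}$ and $|\varepsilon_2(n)|\le C\frac{e^{\gamma\sqrt n}}{\sqrt n}$. $\operatorname{dist}(x,\mathbb{Z})$ is the distance from $x$ to the nearest integer. Two integers have the same sign if both are strictly positive or both are strictly negative. For a real sequence $(a_n)_{n\ge0}$ and $N\ge1$, $a_N$ is a local minimum of the sequence (attained at index $N$) if $a_N\le a_{N-1}$ and $a_N\le a_{N+1}$. *)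

theory Defs
  imports "HOL-Analysis.Analysis"
begin

text \<open>Meaningful for \<open>norm z \<le> 1\<close>, where the series converges absolutely; the index is
  shifted, so the sum runs over \<open>n \<ge> 1\<close>.\<close>

definition dilog :: "complex \<Rightarrow> complex" where
  "dilog z = (\<Sum>n. z ^ Suc n / of_nat (Suc n) ^ 2)"

definition D_const :: real where
  "D_const = Im (dilog (exp (of_real pi * \<i> / 3)))"

lemma D_const_sums: "(\<lambda>n. sin (real (Suc n) * pi / 3) / real (Suc n) ^ 2) sums D_const"
proof -
  define z where "z = exp (of_real pi * \<i> / 3)"
  have z: "z = cis (pi / 3)"
    by (simp add: z_def cis_conv_exp mult.commute)
  have "summable (\<lambda>n. norm (z ^ Suc n / of_nat (Suc n) ^ 2))"
  proof -
    have "summable (\<lambda>n. 1 / real (Suc n) ^ 2)"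
      using inverse_power_summable[of 2, where ?'a = real]
      unfolding summable_Suc_iff[of "\<lambda>n. 1 / real n ^ 2"] by (simp add: inverse_eq_divide)
    moreover have "norm (z ^ Suc n / of_nat (Suc n) ^ 2) = 1 / real (Suc n) ^ 2" for n
      unfolding norm_divide norm_power norm_of_nat by (simp add: z)
    ultimately show ?thesis by simp
  qed
  then have "summable (\<lambda>n. z ^ Suc n / of_nat (Suc n) ^ 2)"
    by (rule summable_norm_cancel)
  then have "(\<lambda>n. z ^ Suc n / of_nat (Suc n) ^ 2) sums dilog z"
    unfolding dilog_def by (rule summable_sums)
  then have "(\<lambda>n. Im (z ^ Suc n / of_nat (Suc n) ^ 2)) sums D_const"
    unfolding D_const_def z_def[symmetric] by (rule sums_Im)
  moreover have "Im (z ^ Suc n / of_nat (Suc n) ^ 2) = sin (real (Suc n) * pi / 3) / real (Suc n) ^ 2" for n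
  proof -
    have "z ^ Suc n / of_nat (Suc n) ^ 2 = cis (real (Suc n) * (pi / 3)) / of_real (real (Suc n) ^ 2)"
      unfolding z Complex.DeMoivre by simp
    then show ?thesis by (simp only: Im_divide_of_real cis.sel times_divide_eq_right)
  qed
  ultimately show ?thesis by simp
qed

definition W2 :: complex where
  "W2 = - (of_real pi)\<^sup>2 / 24 + \<i> / 2 * of_real D_const"

definition W3 :: complex where
  "W3 = \<i> / 2 * of_real D_const"

definition W4 :: complex where
  "W4 = \<i> / 2 * of_real D_const"

definition lambda2 :: real where
  "lambda2 = 2 * Im (csqrt W2)"

definition lambda3 :: real where
  "lambda3 = 2 * Im (csqrt W3)"

definition lambda4 :: real where
  "lambda4 = 2 * Im (csqrt W4)"

definition oscillating_asymptotics ::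
  "real \<Rightarrow> real \<Rightarrow> real \<Rightarrow> real \<Rightarrow> real \<Rightarrow> (nat \<Rightarrow> int) \<Rightarrow> bool" where
  "oscillating_asymptotics \<alpha> \<beta> \<gamma> lam \<phi> V \<longleftrightarrow>
    (\<exists>(\<epsilon>1 :: nat \<Rightarrow> real) (\<epsilon>2 :: nat \<Rightarrow> real) (C :: real) (n0 :: nat).
       C > 0 \<and> n0 \<ge> 1 \<and>
       (\<forall>n\<ge>n0.
          real_of_int (V n) =
            (- 1) ^ n * \<alpha> * (exp (\<beta> * sqrt (real n)) / sqrt (real n))
              * cos (lam * sqrt (real n) + \<phi>) * (1 + \<epsilon>1 n) + \<epsilon>2 n \<and>
          \<bar>\<epsilon>1 n\<bar> \<le> C * real n powr (- 1 / 2) \<and>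
          \<bar>\<epsilon>2 n\<bar> \<le> C * (exp (\<gamma> * sqrt (real n)) / sqrt (real n))))"

definition t_seq :: "real \<Rightarrow> real \<Rightarrow> nat \<Rightarrow> real" where
  "t_seq lam \<phi> m = ((pi - 2 * \<phi> + 2 * real m * pi) / (2 * lam))\<^sup>2"

text \<open>The conversion to \<open>nat\<close> is harmless because \<open>t_seq\<close> is nonnegative.\<close>

definition N_seq :: "real \<Rightarrow> real \<Rightarrow> nat \<Rightarrow> nat" where
  "N_seq lam \<phi> m = nat \<lfloor>t_seq lam \<phi> m\<rfloor>"

text \<open>Strict, unlike \<open>sgn a = sgn b\<close>, which would also hold for \<open>a = b = 0\<close>.\<close>

definition same_sign :: "int \<Rightarrow> int \<Rightarrow> bool" where
  "same_sign a b \<longleftrightarrow> (0 < a \<and> 0 < b) \<or> (a < 0 \<and> b < 0)"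

definition local_min_at :: "(nat \<Rightarrow> real) \<Rightarrow> nat \<Rightarrow> bool" where
  "local_min_at a N \<longleftrightarrow> 1 \<le> N \<and> a N \<le> a (N - 1) \<and> a N \<le> a (N + 1)"

end

theory Submission
  imports Defs "HOL-Real_Asymp.Real_Asymp"
begin

text \<open>
  Put \<open>s = sqrt t\<^sub>m\<close>; it is a zero of \<open>cos (\<lambda> x + \<phi>)\<close>. For an integer \<open>n\<close> within bounded
  distance of \<open>t\<^sub>m\<close>, \<open>sqrt n - s\<close> is about \<open>(n - t\<^sub>m) / (2 s)\<close>, so after division by the
  slowly varying amplitude \<open>\<alpha> \<lambda> exp (\<beta> s) / (2 s\<^sup>2)\<close> the number \<open>V n\<close> equals
  \<open>\<plusminus> (-1)^n (n - t\<^sub>m)\<close> up to an error tending to 0, with a sign that depends only on \<open>m\<close>.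
  At \<open>N - 1, N, N + 1, N + 2\<close> with \<open>N = N\<^sub>m\<close> and \<open>f = t\<^sub>m - N\<close> in \<open>[\<delta>, 1 - \<delta>]\<close>, the absolute values
  are therefore close to \<open>1 + f, f, 1 - f, 2 - f\<close>: the smaller of the middle two is a local minimum,
  and the sign change of \<open>n - t\<^sub>m\<close> between \<open>N\<close> and \<open>N + 1\<close> cancels that of \<open>(-1)^n\<close>.
\<close>

section \<open>Positivity of the dilogarithm constant and of the frequencies\<close>

lemma D_const_pos: "D_const > 0"
proof -
  define f where "f = (\<lambda>n. sin (real (Suc n) * pi / 3) / real (Suc n) ^ 2)"
  \<comment> \<open>The sine has period 6 in the summation index, with values
    \<open>sqrt 3 / 2\<close> times 1, 1, 0, -1, -1, 0. In each block of six the positive terms have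
    the smaller denominators, so every block sum is positive.\<close>
  define g where "g = (\<lambda>k. sum f {k * 6..<k * 6 + 6})"
  have sin_shift: "sin (x + 2 * real k * pi) = sin x" for x :: real and k :: nat
    using sin.plus_of_nat[of x k] by (simp add: mult_ac)
  have sin4: "sin (4 * pi / 3) = - (sqrt 3 / 2)"
    using sin_periodic_pi[of "pi / 3"] by (simp add: sin_60 field_simps)
  have sin5: "sin (5 * pi / 3) = - (sqrt 3 / 2)"
  proof -
    have "sin (5 * pi / 3) = sin (2 * pi / 3 + pi)"
      by (rule arg_cong[of _ _ sin]) simp
    then show ?thesis
      by (simp only: sin_periodic_pi sin_120)
  qed
  have g_pos: "g k > 0" for k
  proof -
    have sin_val: "sin (real (Suc (k * 6 + j)) * pi / 3) = sin (real (Suc j) * pi / 3)" for j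
      using sin_shift[of "real (Suc j) * pi / 3" k] by (simp add: field_simps)
    have "g k = (\<Sum>j<6. f (k * 6 + j))"
      unfolding g_def using sum.shift_bounds_nat_ivl[of f 0 "k * 6" 6]
      by (simp add: add.commute atLeast0LessThan)
    also have "\<dots> = f (k * 6) + f (k * 6 + 1) + f (k * 6 + 2) + f (k * 6 + 3) + f (k * 6 + 4)
        + f (k * 6 + 5)"
      by (simp add: eval_nat_numeral)
    also have "\<dots> = sqrt 3 / 2 * (1 / real (Suc (k * 6)) ^ 2 + 1 / real (Suc (k * 6 + 1)) ^ 2
         - 1 / real (Suc (k * 6 + 3)) ^ 2 - 1 / real (Suc (k * 6 + 4)) ^ 2)"
    proof -
      have "sin (real (Suc (k * 6)) * pi / 3) = sqrt 3 / 2"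
        "sin (real (Suc (k * 6 + 1)) * pi / 3) = sqrt 3 / 2"
        "sin (real (Suc (k * 6 + 2)) * pi / 3) = 0"
        "sin (real (Suc (k * 6 + 3)) * pi / 3) = - (sqrt 3 / 2)"
        "sin (real (Suc (k * 6 + 4)) * pi / 3) = - (sqrt 3 / 2)"
        "sin (real (Suc (k * 6 + 5)) * pi / 3) = 0"
        using sin_val[of 0] sin_val[of 1] sin_val[of 2] sin_val[of 3] sin_val[of 4] sin_val[of 5]
          sin4 sin5 sin_60 sin_120 by simp_all
      then show ?thesis
        unfolding f_def by (simp only:) (simp add: ring_distribs del: of_nat_Suc)
    qed
    also have "\<dots> > 0"
    proof -
      have "1 / real (Suc (k * 6 + 3)) ^ 2 < 1 / real (Suc (k * 6)) ^ 2"
        by (intro divide_strict_left_mono power_strict_mono) auto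
      moreover have "1 / real (Suc (k * 6 + 4)) ^ 2 < 1 / real (Suc (k * 6 + 1)) ^ 2"
        by (intro divide_strict_left_mono power_strict_mono) auto
      ultimately show ?thesis by simp
    qed
    finally show ?thesis .
  qed
  have "g sums D_const"
    unfolding g_def using sums_group[of f D_const 6] D_const_sums by (simp add: f_def)
  then show ?thesis
    using suminf_pos[of g] g_pos by (simp add: sums_iff)
qed

text \<open>For \<open>Im z > 0\<close> the principal root has imaginary part
  \<open>sqrt ((cmod z - Re z) / 2)\<close>, and \<open>Re z < cmod z\<close> is strict off the real
  axis.\<close>

lemma Im_csqrt_pos:
  assumes "Im z > 0"
  shows "Im (csqrt z) > 0"
proof -
  have "Re z < cmod z"
    using assms complex_Re_le_cmod[of z] cmod_eq_Re[of z]
    by (smt (verit) cmod_power2 zero_less_power)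
  then show ?thesis
    using assms by simp
qed

text \<open>All three radicands have imaginary part \<open>D_const / 2\<close>, so their principal
  roots lie in the upper half plane.\<close>

lemma lambda_pos:
  assumes "lam \<in> {lambda2, lambda3, lambda4}"
  shows "lam > 0"
proof -
  have "Im W2 > 0" "Im W3 > 0" "Im W4 > 0"
    using D_const_pos by (auto simp: W2_def W3_def W4_def simp flip: of_real_power)
  then show ?thesis
    using assms Im_csqrt_pos unfolding lambda2_def lambda3_def lambda4_def by auto
qed

section \<open>Linearisation of V near the zeros of the cosine\<close>

definition s_seq :: "real \<Rightarrow> real \<Rightarrow> nat \<Rightarrow> real" where
  "s_seq lam \<phi> m = (pi - 2 * \<phi> + 2 * real m * pi) / (2 * lam)"

lemma s_seq_at_top:
  assumes "lam > 0"
  shows "filterlim (s_seq lam \<phi>) at_top sequentially"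
  unfolding s_seq_def using assms by real_asymp

text \<open>At \<open>s_seq lam \<phi> m\<close> the argument of the cosine is
  \<open>pi / 2 + m * pi\<close>: the quarter turn makes the cosine minus a sine, and the
  \<open>m\<close> half turns contribute \<open>(-1) ^ m\<close>.\<close>

lemma cos_near_zero:
  assumes "lam > 0"
  shows "cos (lam * (s_seq lam \<phi> m + d) + \<phi>) = (-1) ^ Suc m * sin (lam * d)"
proof -
  have "lam * (s_seq lam \<phi> m + d) + \<phi> = (lam * d + real m * pi) + pi / 2"
    using assms by (simp add: s_seq_def field_simps)
  then show ?thesis
    by (simp only: cos_add) (simp add: sin_add cos_add)
qed

text \<open>The factor \<open>c\<close> is the reciprocal of the amplitude in the linear
  approximation of \<open>V\<close>: near the zero \<open>s\<close> the cosine is about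
  \<open>lam * (n - s^2) / (2 * s)\<close> up to sign, and it is multiplied by
  \<open>\<alpha> * exp (\<beta> * s) / s\<close>. The index function \<open>n\<close> is arbitrary
  within bounded distance of \<open>s^2\<close>, so that each neighbour of \<open>N_seq\<close> can
  be treated separately.\<close>

lemma normalized_tendsto:
  fixes V :: "nat \<Rightarrow> int" and n :: "nat \<Rightarrow> nat"
  assumes lam: "lam > 0" and "\<alpha> \<noteq> 0" and "\<beta> > \<gamma>"
    and asym: "oscillating_asymptotics \<alpha> \<beta> \<gamma> lam \<phi> V"
    and near: "\<And>m. \<bar>real (n m) - (s_seq lam \<phi> m)\<^sup>2\<bar> \<le> B"
  defines "c \<equiv> \<lambda>m. 2 * (s_seq lam \<phi> m)\<^sup>2 / (\<alpha> * lam * exp (\<beta> * s_seq lam \<phi> m))"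
  shows "(\<lambda>m. (-1) ^ n m * (-1) ^ Suc m * c m * V (n m) - (real (n m) - (s_seq lam \<phi> m)\<^sup>2))
    \<longlonglongrightarrow> 0"
proof -
  define s where "s = s_seq lam \<phi>"
  define r where "r m = sqrt (real (n m))" for m
  define d where "d m = r m - s m" for m
  define x where "x m = real (n m) - (s m)\<^sup>2" for m
  obtain \<epsilon>1 \<epsilon>2 C n0 where C: "C > 0"
    and V: "\<And>k. k \<ge> n0 \<Longrightarrow> real_of_int (V k) =
            (- 1) ^ k * \<alpha> * (exp (\<beta> * sqrt (real k)) / sqrt (real k))
              * cos (lam * sqrt (real k) + \<phi>) * (1 + \<epsilon>1 k) + \<epsilon>2 k"
    and \<epsilon>1: "\<And>k. k \<ge> n0 \<Longrightarrow> \<bar>\<epsilon>1 k\<bar> \<le> C * real k powr (- 1 / 2)"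
    and \<epsilon>2: "\<And>k. k \<ge> n0 \<Longrightarrow> \<bar>\<epsilon>2 k\<bar> \<le> C * (exp (\<gamma> * sqrt (real k)) / sqrt (real k))"
    using asym unfolding oscillating_asymptotics_def by metis
  have s_top: "filterlim s at_top sequentially"
    unfolding s_def using lam by (rule s_seq_at_top)
  have x_bd: "\<bar>x m\<bar> \<le> B" for m
    using near by (simp add: x_def s_def)
  have n_top: "filterlim (\<lambda>m. real (n m)) at_top sequentially"
  proof (rule filterlim_at_top_mono)
    show "filterlim (\<lambda>m. (s m)\<^sup>2 - B) at_top sequentially"
      by (rule filterlim_compose[OF _ s_top]) real_asymp
    show "\<forall>\<^sub>F m in sequentially. (s m)\<^sup>2 - B \<le> real (n m)"
      using x_bd by (intro always_eventually) (smt (verit) x_def)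
  qed
  then have n_ge: "\<forall>\<^sub>F m in sequentially. n m \<ge> k" for k
    by (auto simp: filterlim_at_top elim: eventually_mono dest: spec[of _ "real k"])
  have r_top: "filterlim r at_top sequentially"
    unfolding r_def by (rule filterlim_compose[OF sqrt_at_top n_top])
  have s_pos: "\<forall>\<^sub>F m in sequentially. s m > 0"
    using s_top by (simp add: filterlim_at_top_dense)
  have r_pos: "\<forall>\<^sub>F m in sequentially. r m > 0"
    using r_top by (simp add: filterlim_at_top_dense)
  \<comment> \<open>The difference of squares takes the place of a Taylor expansion of the square
    root; with \<open>x\<close> bounded it yields \<open>d = O(1 / s)\<close>.\<close>
  have d_eq: "d m * (r m + s m) = x m" for m
    by (simp add: d_def x_def r_def algebra_simps power2_eq_square)
  have d_bd: "\<forall>\<^sub>F m in sequentially. \<bar>d m\<bar> \<le> B * inverse (s m)"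
    using s_pos r_pos
  proof eventually_elim
    case (elim m)
    have "\<bar>d m\<bar> * s m \<le> \<bar>d m\<bar> * (r m + s m)"
      using elim by (intro mult_left_mono) auto
    also have "\<dots> = \<bar>x m\<bar>"
      using elim by (simp add: abs_mult flip: d_eq)
    finally have "\<bar>d m\<bar> * s m \<le> B"
      using x_bd[of m] by simp
    then show ?case
      using elim by (simp add: field_simps)
  qed
  have inv_s: "(\<lambda>m. inverse (s m)) \<longlonglongrightarrow> 0"
    by (rule tendsto_inverse_0_at_top[OF s_top])
  have d_lim: "d \<longlonglongrightarrow> 0"
    by (rule Lim_null_comparison[of _ "\<lambda>m. B * inverse (s m)"])
       (use d_bd tendsto_mult_right_zero[OF inv_s] in \<open>auto\<close>)
  have rs_lim: "(\<lambda>m. r m / s m) \<longlonglongrightarrow> 1"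
  proof (rule Lim_transform_eventually)
    show "(\<lambda>m. 1 + d m * inverse (s m)) \<longlonglongrightarrow> 1"
      using tendsto_add[OF tendsto_const tendsto_mult[OF d_lim inv_s]] by simp
    show "\<forall>\<^sub>F m in sequentially. 1 + d m * inverse (s m) = r m / s m"
      using s_pos by eventually_elim (simp add: d_def field_simps)
  qed
  have sr_lim: "(\<lambda>m. s m / r m) \<longlonglongrightarrow> 1"
    using tendsto_inverse[OF rs_lim] by (simp add: inverse_eq_divide)
  have mid_lim: "(\<lambda>m. 2 * s m / (r m + s m)) \<longlonglongrightarrow> 1"
  proof (rule Lim_transform_eventually)
    show "(\<lambda>m. 2 / (r m / s m + 1)) \<longlonglongrightarrow> 1"
      using tendsto_divide[OF tendsto_const tendsto_add[OF rs_lim tendsto_const], of 1 2] by simp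
    show "\<forall>\<^sub>F m in sequentially. 2 / (r m / s m + 1) = 2 * s m / (r m + s m)"
      using s_pos r_pos by eventually_elim (simp add: field_simps)
  qed
  have \<epsilon>1_lim: "(\<lambda>m. \<epsilon>1 (n m)) \<longlonglongrightarrow> 0"
  proof (rule Lim_null_comparison)
    show "\<forall>\<^sub>F m in sequentially. norm (\<epsilon>1 (n m)) \<le> C * real (n m) powr (- 1 / 2)"
      using n_ge[of n0] by eventually_elim (simp only: real_norm_def \<epsilon>1)
    show "(\<lambda>m. C * real (n m) powr (- 1 / 2)) \<longlonglongrightarrow> 0"
      by (rule filterlim_compose[OF _ n_top]) real_asymp
  qed
  have exp_lim: "(\<lambda>m. exp (a * d m)) \<longlonglongrightarrow> 1" for a
    using tendsto_exp[OF tendsto_mult_right_zero[OF d_lim, of a]] by simp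
  \<comment> \<open>Caratheodory's form of the derivative of the sine at 0 avoids the quotient
    \<open>sin y / y\<close>, since \<open>d m = 0\<close> is possible.\<close>
  obtain h where h: "\<And>y :: real. sin y = h y * y" "isCont h 0" "h 0 = 1"
    using DERIV_sin[of "0 :: real"] unfolding CARAT_DERIV by auto
  have h_lim: "(\<lambda>m. h (lam * d m)) \<longlonglongrightarrow> 1"
    using isCont_tendsto_compose[OF h(2) tendsto_mult_right_zero[OF d_lim, of lam]] h(3) by simp
  \<comment> \<open>With these two quantities the normalised value of \<open>V\<close> is exactly
    \<open>x * G + E\<close>: \<open>G\<close> collects all corrections to the linear term,
    \<open>E\<close> is the rescaled additive error.\<close>
  define G where "G m = exp (\<beta> * d m) * (1 + \<epsilon>1 (n m)) * (s m / r m)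
    * h (lam * d m) * (2 * s m / (r m + s m))" for m
  define E where "E m = (-1) ^ n m * (-1) ^ Suc m * c m * \<epsilon>2 (n m)" for m
  have G_lim: "G \<longlonglongrightarrow> 1"
    unfolding G_def
    using tendsto_mult[OF tendsto_mult[OF tendsto_mult[OF tendsto_mult[OF exp_lim[of \<beta>]
      tendsto_add[OF tendsto_const[of 1] \<epsilon>1_lim]] sr_lim] h_lim] mid_lim] by simp
  \<comment> \<open>Boundedness of \<open>x\<close> turns the relative error \<open>G - 1\<close>
    into an absolute one.\<close>
  have main: "(\<lambda>m. x m * (G m - 1)) \<longlonglongrightarrow> 0"
  proof (rule Lim_null_comparison)
    show "\<forall>\<^sub>F m in sequentially. norm (x m * (G m - 1)) \<le> B * \<bar>G m - 1\<bar>"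
      using x_bd by (intro always_eventually) (auto simp: abs_mult intro!: mult_right_mono)
    have "(\<lambda>m. \<bar>G m - 1\<bar>) \<longlonglongrightarrow> 0"
      using tendsto_rabs[OF tendsto_diff[OF G_lim tendsto_const[of 1]]] by simp
    then show "(\<lambda>m. B * \<bar>G m - 1\<bar>) \<longlonglongrightarrow> 0"
      by (rule tendsto_mult_right_zero)
  qed
  have E_lim: "E \<longlonglongrightarrow> 0"
  proof (rule Lim_null_comparison)
    \<comment> \<open>Writing \<open>r = s + d\<close> in the bound on \<open>\<epsilon>2\<close>
      and multiplying by \<open>c\<close> leaves \<open>s * exp (- (\<beta> - \<gamma>) * s)\<close>
      times convergent factors, which decays because \<open>\<beta> > \<gamma>\<close>.\<close>
    define K where "K = 2 * C / (\<bar>\<alpha>\<bar> * lam)"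
    show "\<forall>\<^sub>F m in sequentially. norm (E m) \<le>
        K * ((s m / r m) * exp (\<gamma> * d m) * (s m * exp (- (\<beta> - \<gamma>) * s m)))"
      using s_pos r_pos n_ge[of n0]
    proof eventually_elim
      case (elim m)
      have "norm (E m) = 2 * (s m)\<^sup>2 / (\<bar>\<alpha>\<bar> * lam * exp (\<beta> * s m)) * \<bar>\<epsilon>2 (n m)\<bar>"
        using lam by (simp add: E_def c_def s_def abs_mult)
      also have "\<dots> \<le> 2 * (s m)\<^sup>2 / (\<bar>\<alpha>\<bar> * lam * exp (\<beta> * s m)) * (C * (exp (\<gamma> * r m) / r m))"
        using elim lam \<epsilon>2[of "n m"] by (intro mult_left_mono) (auto simp: r_def)
      also have "exp (\<gamma> * r m) = exp (\<gamma> * d m) * (exp (- (\<beta> - \<gamma>) * s m) * exp (\<beta> * s m))"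
        unfolding exp_add[symmetric] by (simp add: d_def algebra_simps)
      also have "2 * (s m)\<^sup>2 / (\<bar>\<alpha>\<bar> * lam * exp (\<beta> * s m)) *
          (C * (exp (\<gamma> * d m) * (exp (- (\<beta> - \<gamma>) * s m) * exp (\<beta> * s m)) / r m)) =
          K * ((s m / r m) * exp (\<gamma> * d m) * (s m * exp (- (\<beta> - \<gamma>) * s m)))"
        using elim lam \<open>\<alpha> \<noteq> 0\<close> by (simp add: K_def field_simps power2_eq_square)
      finally show ?case .
    qed
    have "(\<lambda>m. s m * exp (- (\<beta> - \<gamma>) * s m)) \<longlonglongrightarrow> 0"
      using \<open>\<beta> > \<gamma>\<close> by (intro filterlim_compose[OF _ s_top]) real_asymp
    from tendsto_mult[OF tendsto_const[of K] tendsto_mult[OF tendsto_mult[OF sr_lim exp_lim[of \<gamma>]] this]]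
    show "(\<lambda>m. K * ((s m / r m) * exp (\<gamma> * d m) * (s m * exp (- (\<beta> - \<gamma>) * s m)))) \<longlonglongrightarrow> 0"
      by simp
  qed
  show ?thesis
  proof (rule Lim_transform_eventually)
    show "(\<lambda>m. x m * (G m - 1) + E m) \<longlonglongrightarrow> 0"
      using tendsto_add[OF main E_lim] by simp
    show "\<forall>\<^sub>F m in sequentially. x m * (G m - 1) + E m =
        (-1) ^ n m * (-1) ^ Suc m * c m * V (n m) - (real (n m) - (s_seq lam \<phi> m)\<^sup>2)"
      using s_pos r_pos n_ge[of n0]
    proof eventually_elim
      case (elim m)
      define \<sigma> :: real where "\<sigma> = (-1) ^ n m * (-1) ^ Suc m"
      have \<sigma>: "\<sigma> * \<sigma> = 1"
        by (simp add: \<sigma>_def flip: power_mult_distrib power_add)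
      have r_eq: "r m = s m + d m"
        by (simp add: d_def)
      have "cos (lam * r m + \<phi>) = (-1) ^ Suc m * (h (lam * d m) * (lam * d m))"
        unfolding r_eq s_def cos_near_zero[OF lam] h(1)[of "lam * d m"] ..
      moreover have "exp (\<beta> * r m) = exp (\<beta> * s m) * exp (\<beta> * d m)"
        by (simp add: r_eq distrib_left exp_add)
      ultimately have V_eq: "V (n m) = \<sigma> * \<alpha> * (exp (\<beta> * s m) * exp (\<beta> * d m) / r m)
          * (h (lam * d m) * (lam * d m)) * (1 + \<epsilon>1 (n m)) + \<epsilon>2 (n m)"
        using V[of "n m"] elim by (simp add: \<sigma>_def r_def)
      have c_eq: "c m * \<alpha> * exp (\<beta> * s m) * lam = 2 * (s m)\<^sup>2"
        using lam \<open>\<alpha> \<noteq> 0\<close> by (simp add: c_def s_def)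
      have "\<sigma> * c m * V (n m) = (\<sigma> * \<sigma>) * (c m * \<alpha> * exp (\<beta> * s m) * lam)
          * (exp (\<beta> * d m) / r m * h (lam * d m) * d m * (1 + \<epsilon>1 (n m))) + \<sigma> * c m * \<epsilon>2 (n m)"
        unfolding V_eq by (simp only: distrib_left mult_ac times_divide_eq_right)
      also have "\<dots> = (d m * (r m + s m)) * G m + E m"
        unfolding \<sigma> c_eq using elim by (simp add: G_def E_def \<sigma>_def power2_eq_square)
      also have "\<dots> = x m * G m + E m"
        by (simp only: d_eq)
      finally show ?case
        by (simp add: x_def s_def \<sigma>_def algebra_simps)
    qed
  qed
qed

section \<open>Signs and local minima from four normalised neighbours\<close>

theorem theorem7:
  fixes lam \<phi> \<alpha> \<beta> \<gamma> \<delta> :: real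
    and V :: "nat \<Rightarrow> int"
    and M :: "nat set"
  assumes "lam \<in> {lambda2, lambda3, lambda4}"
    and "\<phi> = pi / 4"
    and "\<alpha> \<noteq> 0"
    and "\<beta> > \<gamma>"
    and "\<gamma> > 0"
    and "oscillating_asymptotics \<alpha> \<beta> \<gamma> lam \<phi> V"
    and "\<delta> > 0"
    and "infinite M"
    and "\<And>m. m \<in> M \<Longrightarrow> infdist (t_seq lam \<phi> m) \<int> \<ge> \<delta>"
    and "\<And>m. m \<in> M \<Longrightarrow> N_seq lam \<phi> m > 1"
  shows "\<exists>m0. \<forall>m\<in>M. m \<ge> m0 \<longrightarrow>
      same_sign (V (N_seq lam \<phi> m)) (V (N_seq lam \<phi> m + 1)) \<and>
      (local_min_at (\<lambda>n. real_of_int \<bar>V n\<bar>) (N_seq lam \<phi> m) \<or>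
       local_min_at (\<lambda>n. real_of_int \<bar>V n\<bar>) (N_seq lam \<phi> m + 1))"
proof -
  define N where "N = N_seq lam \<phi>"
  define t where "t = t_seq lam \<phi>"
  define s where "s = s_seq lam \<phi>"
  define c where "c m = 2 * (s m)\<^sup>2 / (\<alpha> * lam * exp (\<beta> * s m))" for m
  have lam: "lam > 0"
    using assms(1) by (rule lambda_pos)
  have t_s: "t m = (s m)\<^sup>2" for m
    by (simp add: t_def s_def t_seq_def s_seq_def)
  have N: "real (N m) \<le> t m" "t m < real (N m) + 1" for m
  proof -
    have "real (N m) = of_int \<lfloor>t m\<rfloor>"
      using t_s by (simp add: N_def N_seq_def t_def)
    then show "real (N m) \<le> t m" "t m < real (N m) + 1"
      by linarith+
  qed
  \<comment> \<open>The values \<open>j = 0, 1, 2, 3\<close> stand for the indices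
    \<open>N - 1, N, N + 1, N + 2\<close>; the subtraction truncates only for \<open>N m = 0\<close>
    and \<open>j = 0\<close>.\<close>
  define y where "y j m = (-1) ^ (N m + j - 1) * (-1) ^ Suc m * c m * V (N m + j - 1)" for j m
  \<comment> \<open>An error below \<open>\<delta>\<close> preserves the signs of the two middle
    values; errors below \<open>1 / 2\<close> preserve the order of absolute values that differ by 1
    in the limit.\<close>
  define e where "e = min \<delta> (1 / 2)"
  have close: "\<forall>\<^sub>F m in sequentially. \<forall>j\<in>{..3}. \<bar>y j m - (real (N m + j - 1) - t m)\<bar> < e"
  proof (rule eventually_ball_finite, simp, rule ballI)
    fix j :: nat
    assume "j \<in> {..3}"
    \<comment> \<open>The bound must hold for every \<open>m\<close>, including those with truncated
      subtraction; 4 is generous.\<close>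
    then have "\<bar>real (N m + j - 1) - t m\<bar> \<le> 4" for m
      using N[of m] by (simp add: of_nat_diff_if abs_le_iff split: if_splits)
    then have "(\<lambda>m. y j m - (real (N m + j - 1) - t m)) \<longlonglongrightarrow> 0"
      using normalized_tendsto[OF lam assms(3,4,6), of "\<lambda>m. N m + j - 1" 4]
      by (simp add: y_def c_def s_def t_s)
    moreover have "e > 0"
      using assms(7) by (simp add: e_def)
    ultimately show "\<forall>\<^sub>F m in sequentially. \<bar>y j m - (real (N m + j - 1) - t m)\<bar> < e"
      by (simp add: tendsto_iff dist_real_def)
  qed
  have "\<forall>\<^sub>F m in sequentially. s m > 0"
    using s_seq_at_top[OF lam] by (simp add: filterlim_at_top_dense s_def)
  then have "\<forall>\<^sub>F m in sequentially. m \<in> M \<longrightarrow>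
      same_sign (V (N m)) (V (N m + 1)) \<and>
      (local_min_at (\<lambda>n. real_of_int \<bar>V n\<bar>) (N m) \<or>
       local_min_at (\<lambda>n. real_of_int \<bar>V n\<bar>) (N m + 1))"
    using close
  proof eventually_elim
    case (elim m)
    show ?case
    proof
      assume mM: "m \<in> M"
      have N1: "N m > 1"
        using assms(10)[OF mM] by (simp add: N_def)
      have cl: "\<bar>y 0 m - (real (N m) - 1 - t m)\<bar> < e" "\<bar>y 1 m - (real (N m) - t m)\<bar> < e"
          "\<bar>y 2 m - (real (N m) + 1 - t m)\<bar> < e" "\<bar>y 3 m - (real (N m) + 2 - t m)\<bar> < e"
        using elim(2)[rule_format, of 0] elim(2)[rule_format, of 1] elim(2)[rule_format, of 2]
          elim(2)[rule_format, of 3] N1 by (simp_all add: of_nat_diff add_ac)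
      have c: "c m \<noteq> 0"
        using elim(1) lam assms(3) by (simp add: c_def)
      \<comment> \<open>The distance to the set of integers bounds the distance to each of the two
        neighbouring integers from below.\<close>
      have "\<delta> \<le> dist (t m) (real (N m))" "\<delta> \<le> dist (t m) (real (N m) + 1)"
        using assms(9)[OF mM] infdist_le[of "real (N m)" \<int> "t m"]
          infdist_le[of "real (N m) + 1" \<int> "t m"] by (auto simp: t_def)
      then have f: "real (N m) + \<delta> \<le> t m" "t m \<le> real (N m) + 1 - \<delta>"
        using N[of m] by (auto simp: dist_real_def)
      have e: "e \<le> \<delta>" "e \<le> 1 / 2"
        by (auto simp: e_def)
      have y: "y 1 m < 0" "0 < y 2 m" "\<bar>y 1 m\<bar> \<le> \<bar>y 0 m\<bar>" "\<bar>y 2 m\<bar> \<le> \<bar>y 3 m\<bar>"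
        using cl f e assms(7) by linarith+
      have abs_y: "\<bar>y j m\<bar> = \<bar>c m\<bar> * \<bar>V (N m + j - 1)\<bar>" for j
        by (simp add: y_def abs_mult)
      have le_iff: "\<bar>y i m\<bar> \<le> \<bar>y j m\<bar> \<longleftrightarrow> \<bar>V (N m + i - 1)\<bar> \<le> \<bar>V (N m + j - 1)\<bar>" for i j
        unfolding abs_y using c by (simp del: of_int_abs)
      \<comment> \<open>Consecutive parities give the minus sign, so opposite signs of
        \<open>y\<close> mean equal signs of \<open>V\<close>. The square removes the sign of
        \<open>c m\<close>, which is that of \<open>\<alpha>\<close>.\<close>
      have "y 1 m * y 2 m = - ((c m)\<^sup>2 * (V (N m) * V (N m + 1)))"
        by (simp add: y_def power2_eq_square mult_ac flip: power_add)
      then have "(c m)\<^sup>2 * real_of_int (V (N m) * V (N m + 1)) > 0"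
        using mult_neg_pos[OF y(1,2)] by simp
      then have "V (N m) * V (N m + 1) > 0"
        using c by (simp only: zero_less_mult_iff of_int_0_less_iff) auto
      then have "same_sign (V (N m)) (V (N m + 1))"
        by (simp add: same_sign_def zero_less_mult_iff)
      moreover have "\<bar>V (N m)\<bar> \<le> \<bar>V (N m - 1)\<bar>" "\<bar>V (N m + 1)\<bar> \<le> \<bar>V (N m + 2)\<bar>"
        using y(3,4) unfolding le_iff by (simp_all add: numeral_2_eq_2 numeral_3_eq_3)
      ultimately show "same_sign (V (N m)) (V (N m + 1)) \<and>
        (local_min_at (\<lambda>n. real_of_int \<bar>V n\<bar>) (N m) \<or>
         local_min_at (\<lambda>n. real_of_int \<bar>V n\<bar>) (N m + 1))"
        using N1 by (cases "\<bar>V (N m)\<bar> \<le> \<bar>V (N m + 1)\<bar>")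
          (simp_all add: local_min_at_def numeral_2_eq_2 del: of_int_abs)
    qed
  qed
  then show ?thesis
    by (auto simp: eventually_sequentially N_def)
qed

end
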